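(* Let $(W,W')$ be an exchangeable pair of real random variables, let $\Delta = W-W'$, and suppose that $$E(W-W'\mid W) = 1/c_0 + r(W)$$ for a constant $c_0>0$ and a measurable function $r$. Let $Y$ have the exponential distribution with mean $1$. (i) If $h$ is absolutely continuous with $\|h'\|=\sup_x|h'(x)|<\infty$, then $$|Eh(W)-Eh(Y)| \le \|h'\|\big\{E\big|1-(c_0/2)E(\Delta^2\mid W)\big| + c_0E|\Delta|^3 + 3c_0E|W r(W)|\big\}.$$ (ii) If $|\Delta|\le\delta$ for some constant $\delta$, then for all real $z$, $$|P(W\le z)-P(Y\le z)| \le 3E\big|1-(c_0/2)E(\Delta^2\mid W)\big| + \delta + 2c_0\delta^3 + 3c_0E|Wr(W)|.$$
   Context: A pair $(W,W')$ is exchangeable if $(W,W')$ and $(W',W)$ have the same joint distribution. *)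

theory Defs
  imports "HOL-Probability.Probability"
begin

definition abs_continuous_on_interval :: "real \<Rightarrow> real \<Rightarrow> (real \<Rightarrow> real) \<Rightarrow> bool" where
  "abs_continuous_on_interval a b h \<longleftrightarrow>
     (\<forall>\<epsilon>>0. \<exists>\<delta>>0. \<forall>(n::nat) (l::nat \<Rightarrow> real) (u::nat \<Rightarrow> real).
        (\<forall>i<n. a \<le> l i \<and> l i \<le> u i \<and> u i \<le> b) \<and>
        (\<forall>i<n. \<forall>j<n. i \<noteq> j \<longrightarrow> u i \<le> l j \<or> u j \<le> l i) \<and>
        (\<Sum>i<n. u i - l i) < \<delta>
        \<longrightarrow> (\<Sum>i<n. \<bar>h (u i) - h (l i)\<bar>) < \<epsilon>)"

definition abs_continuous :: "(real \<Rightarrow> real) \<Rightarrow> bool" where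
  "abs_continuous h \<longleftrightarrow> (\<forall>a b. a \<le> b \<longrightarrow> abs_continuous_on_interval a b h)"

definition exchangeable :: "'a measure \<Rightarrow> ('a \<Rightarrow> real) \<Rightarrow> ('a \<Rightarrow> real) \<Rightarrow> bool" where
  "exchangeable M W W' \<longleftrightarrow>
     distr M (borel \<Otimes>\<^sub>M borel) (\<lambda>x. (W x, W' x)) = distr M (borel \<Otimes>\<^sub>M borel) (\<lambda>x. (W' x, W x))"

definition sigma_of :: "'a measure \<Rightarrow> ('a \<Rightarrow> real) \<Rightarrow> 'a measure" where
  "sigma_of M W = vimage_algebra (space M) W borel"

end

theory Submission
  imports Defs
begin

text \<open>
  For a test function \<open>h\<close> the bounded solution of \<open>f' - f = h - E h(Y)\<close> is
  \<open>f(w) = E h(Y) - E h(w + Y)\<close>; it vanishes at \<open>0\<close>, so if \<open>h\<close> is \<open>L\<close>-Lipschitz then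
  \<open>|f(w)| \<le> L |w|\<close> and \<open>f'\<close> is bounded by \<open>L\<close> and \<open>2L\<close>-Lipschitz. Exchangeability gives
  \<open>(c\<^sub>0/2) E \<Delta>(f(W) - f(W')) = E f(W) + c\<^sub>0 E f(W) r(W)\<close>, and the first bound is a Taylor
  expansion of the left-hand side. As \<open>W \<Delta>\<close> need not be integrable, \<open>h\<close> is first clipped.

  For \<open>h = 1{\<cdot> \<le> z}\<close> the derivative \<open>f'\<close> jumps at \<open>z\<close>. Replacing \<open>f'(W)\<close> by
  \<open>(f'(W) + f'(W'))/2\<close>, the jump contributes at most
  \<open>(c\<^sub>0/4) E \<Delta>\<^sup>2 1{z lies between W and W'}\<close>, and the same identity applied to a truncation of
  \<open>w - z\<close> bounds this by \<open>\<delta> + (c\<^sub>0/2) E|W r(W)|\<close>.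
\<close>

subsection \<open>Absolutely continuous functions with bounded derivative\<close>

text \<open>Take a tagged division fine for a gauge that keeps intervals tagged in the exceptional null set
  inside a small open set: those contribute little by absolute continuity, the others have
  slope at most about \<open>L\<close>.\<close>

lemma lipschitz_on_interval_if_ae_bounded_derivative:
  fixes h h' :: "real \<Rightarrow> real"
  assumes ab: "a \<le> b"
    and ac: "abs_continuous_on_interval a b h"
    and ae: "AE x in lborel. (h has_real_derivative h' x) (at x)"
    and bd: "\<And>x. \<bar>h' x\<bar> \<le> L"
  shows "\<bar>h b - h a\<bar> \<le> L * (b - a)"
proof -
  have main: "\<bar>h b - h a\<bar> \<le> e + (L + e) * (b - a)" if e: "e > 0" for e
  proof -
    obtain d where d: "d > 0" and
      dP: "\<forall>(n::nat) l u. (\<forall>i<n. a \<le> l i \<and> l i \<le> u i \<and> u i \<le> b) \<and>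
          (\<forall>i<n. \<forall>j<n. i \<noteq> j \<longrightarrow> u i \<le> l j \<or> u j \<le> l i) \<and> (\<Sum>i<n. u i - l i) < d
          \<longrightarrow> (\<Sum>i<n. \<bar>h (u i) - h (l i)\<bar>) < e"
      using ac[unfolded abs_continuous_on_interval_def, THEN spec, THEN mp, OF e] by (elim exE conjE)
    obtain N where N: "N \<in> null_sets lborel"
      and Nd: "{x. \<not> (h has_real_derivative h' x) (at x)} \<subseteq> N"
      using ae by (auto elim!: AE_E simp: null_sets_def)
    have "N \<in> sets borel" using N by auto
    then obtain U where U: "open U" "N \<subseteq> U" and "emeasure lborel (U - N) < d"
      using outer_regular_lborel[OF _ d] by metis
    have Ub[measurable]: "U \<in> sets borel" using U by auto
    have "emeasure lborel U = emeasure lborel (U - N)"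
      using N U by (intro emeasure_Diff_null_set[symmetric]) auto
    then have Ud: "emeasure lborel U < d" using \<open>emeasure lborel (U - N) < d\<close> by simp
    have "\<exists>g>0. if x \<in> N then ball x g \<subseteq> U
         else \<forall>y\<in>ball x g. \<bar>h y - h x - h' x * (y - x)\<bar> \<le> e * \<bar>y - x\<bar>" for x
    proof (cases "x \<in> N")
      case True
      then show ?thesis using U by (auto simp: open_contains_ball)
    next
      case False
      then have "(h has_derivative (*) (h' x)) (at x)"
        using Nd by (auto simp: has_field_derivative_def)
      then obtain g where "g > 0" "\<forall>y. norm (y - x) < g \<longrightarrow> norm (h y - h x - h' x * (y - x)) \<le> e * norm (y - x)"
        using e unfolding has_derivative_at_alt by blast
      then show ?thesis using False
        by (intro exI[of _ g]) (auto simp: dist_real_def abs_minus_commute)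
    qed
    then obtain g where g: "\<And>x. g x > 0" and gP: "\<And>x. if x \<in> N then ball x (g x) \<subseteq> U
         else \<forall>y\<in>ball x (g x). \<bar>h y - h x - h' x * (y - x)\<bar> \<le> e * \<bar>y - x\<bar>" by metis
    have "gauge (\<lambda>x. ball x (g x))" using g by (auto simp: gauge_def)
    then obtain p where p: "p tagged_division_of {a..b}" and fine: "(\<lambda>x. ball x (g x)) fine p"
      by (rule fine_division_exists_real)
    have fin: "finite p" using p by auto
    have K: "x \<in> K \<and> K \<subseteq> {a..b} \<and> K = {Inf K..Sup K} \<and> Inf K \<le> x \<and> x \<le> Sup K
        \<and> a \<le> Inf K \<and> Sup K \<le> b \<and> {Inf K..Sup K} \<subseteq> ball x (g x)" if xK: "(x, K) \<in> p" for x K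
    proof -
      obtain c1 c2 where c: "x \<in> K" "K \<subseteq> {a..b}" "K = cbox c1 c2"
        using tagged_division_ofD(2-4)[OF p xK] by blast
      then have "c1 \<le> c2" by auto
      then have "Inf K = c1" "Sup K = c2" using c by auto
      moreover have "K \<subseteq> ball x (g x)" using fine xK by (auto simp: fine_def)
      ultimately show ?thesis using c \<open>c1 \<le> c2\<close> by auto
    qed
    define l u where "l = (\<lambda>(x::real, K::real set). Inf K)" and "u = (\<lambda>(x::real, K::real set). Sup K)"
    have lu: "l t \<le> u t" "a \<le> l t" "u t \<le> b" if "t \<in> p" for t
      using K[of "fst t" "snd t"] that by (auto simp: l_def u_def split_beta)
    \<comment> \<open>Only intervals of positive length are ordered here: a one-point interval has
      empty interior, so it may sit inside another member of the division.\<close>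
    have disj: "u s \<le> l t \<or> u t \<le> l s"
      if "s \<in> p" "t \<in> p" "s \<noteq> t" "l s < u s" "l t < u t" for s t
    proof -
      have *: "interior (snd s) \<inter> interior (snd t) = {}"
        using tagged_division_ofD(5)[OF p, of "fst s" "snd s" "fst t" "snd t"] that by auto
      have "snd s = {l s..u s}" "snd t = {l t..u t}"
        using K[of "fst s" "snd s"] K[of "fst t" "snd t"] that by (auto simp: l_def u_def split_beta)
      then have **: "{l s<..<u s} \<inter> {l t<..<u t} = {}"
        using * interior_atLeastAtMost_real by simp
      show ?thesis
      proof (rule ccontr)
        assume "\<not> ?thesis"
        then have "max (l s) (l t) < min (u s) (u t)" using that by auto
        then obtain m where "max (l s) (l t) < m" "m < min (u s) (u t)" using dense by blast
        then have "m \<in> {l s<..<u s} \<inter> {l t<..<u t}" by auto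
        then show False using ** by blast
      qed
    qed
    \<comment> \<open>These intervals lie in \<open>U\<close> and overlap at most in endpoints, so
      their total length is below \<open>d\<close> and absolute continuity applies to them.\<close>
    define q where "q = {t \<in> p. fst t \<in> N \<and> l t < u t}"
    have qp: "q \<subseteq> p" and finq: "finite q" using fin by (auto simp: q_def)
    have q_small: "(\<Sum>t\<in>q. \<bar>h (u t) - h (l t)\<bar>) < e"
    proof -
      have "(\<Sum>t\<in>q. u t - l t) = (\<Sum>t\<in>q. measure lborel {l t<..<u t})"
        by (intro sum.cong) (auto simp: q_def)
      also have "\<dots> = measure lborel (\<Union>t\<in>q. {l t<..<u t})"
      proof (rule measure_finite_Union[symmetric])
        show "disjoint_family_on (\<lambda>t. {l t<..<u t}) q"
          unfolding disjoint_family_on_def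
        proof (intro ballI impI)
          fix s t assume "s \<in> q" "t \<in> q" "s \<noteq> t"
          then have "u s \<le> l t \<or> u t \<le> l s" by (intro disj) (auto simp: q_def)
          then show "{l s<..<u s} \<inter> {l t<..<u t} = {}" by auto
        qed
      qed (use finq in \<open>auto simp: q_def\<close>)
      also have "\<dots> \<le> measure lborel U"
      proof (rule measure_mono_fmeasurable)
        show "U \<in> fmeasurable lborel" using Ud by (auto simp: fmeasurable_def intro: less_trans)
        show "(\<Union>t\<in>q. {l t<..<u t}) \<subseteq> U"
        proof safe
          fix x K y assume "(x, K) \<in> q" "y \<in> {l (x, K)<..<u (x, K)}"
          then show "y \<in> U"
            using K[of x K] gP[of x] by (force simp: q_def l_def u_def)
        qed
      qed (auto intro!: borel_open)
      also have "\<dots> < d"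
      proof -
        have "emeasure lborel U = ennreal (measure lborel U)"
          using Ud by (intro emeasure_eq_ennreal_measure) auto
        then show ?thesis using Ud by (simp add: ennreal_less_iff)
      qed
      finally have len: "(\<Sum>t\<in>q. u t - l t) < d" .
      obtain f where f: "bij_betw f {..<card q} q"
        using ex_bij_betw_nat_finite[OF finq] by (auto simp: atLeast0LessThan)
      have fq: "f i \<in> q" if "i < card q" for i
        using f that by (auto simp: bij_betw_def)
      have "(\<Sum>i<card q. \<bar>h (u (f i)) - h (l (f i))\<bar>) < e"
      proof (rule dP[THEN spec, THEN spec, THEN spec, THEN mp], intro conjI)
        show "\<forall>i<card q. a \<le> l (f i) \<and> l (f i) \<le> u (f i) \<and> u (f i) \<le> b"
          using fq lu qp by blast
        show "\<forall>i<card q. \<forall>j<card q. i \<noteq> j \<longrightarrow> u (f i) \<le> l (f j) \<or> u (f j) \<le> l (f i)"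
        proof (intro allI impI)
          fix i j assume ij: "i < card q" "j < card q" "i \<noteq> j"
          then have "f i \<noteq> f j" using f by (auto simp: bij_betw_def inj_on_def)
          then show "u (f i) \<le> l (f j) \<or> u (f j) \<le> l (f i)"
            using fq[of i] fq[of j] ij by (intro disj) (auto simp: q_def)
        qed
        show "(\<Sum>i<card q. u (f i) - l (f i)) < d"
          using len sum.reindex_bij_betw[OF f, of "\<lambda>t. u t - l t"] by simp
      qed
      then show ?thesis
        using sum.reindex_bij_betw[OF f, of "\<lambda>t. \<bar>h (u t) - h (l t)\<bar>"] by simp
    qed
    have other: "\<bar>h (u t) - h (l t)\<bar> \<le> (L + e) * (u t - l t)" if t: "t \<in> p - q" for t
    proof (cases "l t = u t")
      case False
      obtain x K' where tx: "t = (x, K')" by (cases t)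
      then have xK: "(x, K') \<in> p" using t by auto
      note KK = K[OF xK]
      have xN: "x \<notin> N" using False t lu[of t] tx by (auto simp: q_def)
      have lx: "l t \<le> x" "x \<le> u t" and sub: "{l t..u t} \<subseteq> ball x (g x)"
        using KK unfolding tx l_def u_def prod.case by blast+
      have mem: "l t \<in> ball x (g x)" "u t \<in> ball x (g x)"
        using lx by (rule_tac [!] subsetD[OF sub]) auto
      \<comment> \<open>The tag lies between the endpoints, so the linearisation errors at the two
        ends add up to exactly \<open>e\<close> times the length.\<close>
      have 1: "\<bar>h (u t) - h x - h' x * (u t - x)\<bar> \<le> e * (u t - x)"
        using gP[of x] xN mem lx by force
      have 2: "\<bar>h (l t) - h x - h' x * (l t - x)\<bar> \<le> e * (x - l t)"
        using gP[of x] xN mem lx by force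
      have 3: "\<bar>h' x * (u t - l t)\<bar> \<le> L * (u t - l t)"
        using bd[of x] lx by (simp add: abs_mult mult_right_mono)
      show ?thesis using 1 2 3 by (simp add: algebra_simps abs_le_iff)
    qed simp
    have L0: "0 \<le> L" using bd[of 0] by linarith
    have "h b - h a = (\<Sum>t\<in>p. h (u t) - h (l t))"
      using additive_tagged_division_1[OF ab p, of h] by (simp add: l_def u_def split_beta)
    then have "\<bar>h b - h a\<bar> \<le> (\<Sum>t\<in>p. \<bar>h (u t) - h (l t)\<bar>)" by simp
    also have "\<dots> = (\<Sum>t\<in>q. \<bar>h (u t) - h (l t)\<bar>) + (\<Sum>t\<in>p - q. \<bar>h (u t) - h (l t)\<bar>)"
      by (subst sum.subset_diff[OF qp fin]) simp
    also have "\<dots> \<le> e + (\<Sum>t\<in>p - q. (L + e) * (u t - l t))"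
      using q_small other by (intro add_mono sum_mono) auto
    also have "\<dots> \<le> e + (\<Sum>t\<in>p. (L + e) * (u t - l t))"
      using fin lu L0 e by (intro add_left_mono sum_mono2) auto
    also have "(\<Sum>t\<in>p. (L + e) * (u t - l t)) = (L + e) * (b - a)"
      using additive_tagged_division_1[OF ab p, of "\<lambda>x. x"]
      by (simp add: l_def u_def split_beta flip: sum_distrib_left)
    finally show ?thesis by simp
  qed
  \<comment> \<open>The estimate holds for every positive \<open>e\<close>; let \<open>e\<close>
    tend to 0 from the right.\<close>
  have "((\<lambda>e. e + (L + e) * (b - a)) \<longlongrightarrow> 0 + (L + 0) * (b - a)) (at_right 0)"
    by (intro tendsto_intros)
  moreover have "eventually (\<lambda>e. \<bar>h b - h a\<bar> \<le> e + (L + e) * (b - a)) (at_right 0)"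
    using main by (auto simp: eventually_at_right_less eventually_at_filter)
  ultimately show ?thesis
    using tendsto_lowerbound by fastforce
qed

subsection \<open>The exchangeable pair identity\<close>

lemma abs_integral_le_AE:
  fixes f g :: "'a \<Rightarrow> real"
  assumes f: "f \<in> borel_measurable M" and g: "integrable M g" and le: "AE x in M. \<bar>f x\<bar> \<le> g x"
  shows "\<bar>\<integral>x. f x \<partial>M\<bar> \<le> (\<integral>x. g x \<partial>M)"
proof -
  have "integrable M f"
    using le by (intro Bochner_Integration.integrable_bound[OF g f]) auto
  have "\<bar>\<integral>x. f x \<partial>M\<bar> \<le> (\<integral>x. \<bar>f x\<bar> \<partial>M)" by simp
  also have "\<dots> \<le> (\<integral>x. g x \<partial>M)"
    using \<open>integrable M f\<close> g le by (intro integral_mono_AE) auto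
  finally show ?thesis .
qed

lemma subalgebra_sigma_of:
  assumes "W \<in> borel_measurable M"
  shows "subalgebra M (sigma_of M W)"
  unfolding subalgebra_def sigma_of_def sets_vimage_algebra space_vimage_algebra
  using measurable_sets[OF assms] by (intro conjI refl sets.sigma_sets_subset) auto

lemma measurable_sigma_of:
  assumes "W \<in> borel_measurable M" "\<phi> \<in> borel_measurable borel"
  shows "(\<lambda>x. \<phi> (W x)) \<in> borel_measurable (sigma_of M W)"
proof -
  have "W \<in> sigma_of M W \<rightarrow>\<^sub>M borel"
    unfolding sigma_of_def by (intro measurable_vimage_algebra1) auto
  then show ?thesis using assms(2) by (rule measurable_compose)
qed

text \<open>Integrability of \<open>W - W'\<close> comes from two sources: in the Lipschitz bound
  from that of \<open>W\<close> and \<open>W'\<close>, in the Kolmogorov bound from the almost sure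
  bound \<open>\<delta>\<close>.\<close>

locale stein_exponential_pair = prob_space M for M :: "'a measure" +
  fixes W W' :: "'a \<Rightarrow> real" and r :: "real \<Rightarrow> real" and c0 :: real
  assumes W[measurable]: "W \<in> borel_measurable M" and W'[measurable]: "W' \<in> borel_measurable M"
    and exch: "exchangeable M W W'"
    and c0: "c0 > 0"
    and r[measurable]: "r \<in> borel_measurable borel"
    and regression: "AE x in M. real_cond_exp M (sigma_of M W) (\<lambda>x. W x - W' x) x = 1 / c0 + r (W x)"
    and Wr: "integrable M (\<lambda>x. W x * r (W x))"
    and diff_integrable: "integrable M (\<lambda>x. W x - W' x)"
begin

sublocale finite_measure_subalgebra M "sigma_of M W"
  by unfold_locales (rule subalgebra_sigma_of[OF W])

definition second_moment_defect :: real where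
  "second_moment_defect =
     (\<integral>x. \<bar>1 - (c0 / 2) * real_cond_exp M (sigma_of M W) (\<lambda>x. (W x - W' x)\<^sup>2) x\<bar> \<partial>M)"

lemma exchange_integral:
  fixes g :: "real \<Rightarrow> real \<Rightarrow> real"
  assumes [measurable]: "(\<lambda>(a, b). g a b) \<in> borel_measurable (borel \<Otimes>\<^sub>M borel)"
  shows "(\<integral>x. g (W x) (W' x) \<partial>M) = (\<integral>x. g (W' x) (W x) \<partial>M)"
proof -
  have "(\<integral>x. g (W x) (W' x) \<partial>M)
      = (\<integral>p. (\<lambda>(a, b). g a b) p \<partial>distr M (borel \<Otimes>\<^sub>M borel) (\<lambda>x. (W x, W' x)))"
    by (subst integral_distr) auto
  also have "\<dots> = (\<integral>p. (\<lambda>(a, b). g a b) p \<partial>distr M (borel \<Otimes>\<^sub>M borel) (\<lambda>x. (W' x, W x)))"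
    using exch by (simp add: exchangeable_def)
  also have "\<dots> = (\<integral>x. g (W' x) (W x) \<partial>M)"
    by (subst integral_distr) auto
  finally show ?thesis .
qed

text \<open>The factor \<open>\<phi> (W x)\<close> is measurable for the sigma-algebra of
  \<open>W\<close>, so it can be moved through the conditional expectation. This is applied with
  \<open>Z\<close> equal to the difference (regression condition) and to its square (second moment
  defect).\<close>

lemma cond_exp_mult:
  fixes \<phi> :: "real \<Rightarrow> real"
  assumes [measurable]: "\<phi> \<in> borel_measurable borel"
    and "\<And>w. \<bar>\<phi> w\<bar> \<le> B" and Z: "integrable M Z"
  shows "integrable M (\<lambda>x. \<phi> (W x) * Z x)"
    and "integrable M (\<lambda>x. \<phi> (W x) * real_cond_exp M (sigma_of M W) Z x)"
    and "(\<integral>x. \<phi> (W x) * real_cond_exp M (sigma_of M W) Z x \<partial>M) = (\<integral>x. \<phi> (W x) * Z x \<partial>M)"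
proof -
  have [measurable]: "Z \<in> borel_measurable M" using Z by auto
  show *: "integrable M (\<lambda>x. \<phi> (W x) * Z x)"
    using assms(2) by (intro Bochner_Integration.integrable_bound[OF integrable_mult_right[OF Z, of B]])
      (auto simp: abs_mult intro!: mult_mono AE_I2 order_trans[OF assms(2) abs_ge_self])
  show "integrable M (\<lambda>x. \<phi> (W x) * real_cond_exp M (sigma_of M W) Z x)"
    and "(\<integral>x. \<phi> (W x) * real_cond_exp M (sigma_of M W) Z x \<partial>M) = (\<integral>x. \<phi> (W x) * Z x \<partial>M)"
    using real_cond_exp_intg[OF * measurable_sigma_of[OF W assms(1)]] by auto
qed

text \<open>Exchanging the pair shows that the expectations of
  \<open>f (W' x) * (W x - W' x)\<close> and \<open>f (W x) * (W x - W' x)\<close> are opposite, so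
  the left-hand integral is twice the latter; conditioning on \<open>W\<close> then brings in the
  regression condition. The bound \<open>B\<close> secures integrability, while the linear growth
  bound lets \<open>W * r(W)\<close> dominate \<open>f(W) * r(W)\<close>.\<close>

lemma stein_identity:
  fixes f :: "real \<Rightarrow> real"
  assumes [measurable]: "f \<in> borel_measurable borel"
    and fB: "\<And>w. \<bar>f w\<bar> \<le> B" and fL: "\<And>w. \<bar>f w\<bar> \<le> L * \<bar>w\<bar>"
  shows "integrable M (\<lambda>x. f (W x) * r (W x))"
    and "integrable M (\<lambda>x. (W x - W' x) * (f (W x) - f (W' x)))"
    and "c0 / 2 * (\<integral>x. (W x - W' x) * (f (W x) - f (W' x)) \<partial>M)
       = (\<integral>x. f (W x) \<partial>M) + c0 * (\<integral>x. f (W x) * r (W x) \<partial>M)"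
    and "\<bar>\<integral>x. f (W x) * r (W x) \<partial>M\<bar> \<le> L * (\<integral>x. \<bar>W x * r (W x)\<bar> \<partial>M)"
proof -
  have bd: "\<bar>f w * r w\<bar> \<le> L * \<bar>w * r w\<bar>" for w
    using mult_right_mono[OF fL[of w], of "\<bar>r w\<bar>"] by (simp add: abs_mult mult.assoc)
  show fr: "integrable M (\<lambda>x. f (W x) * r (W x))"
    using bd by (intro Bochner_Integration.integrable_bound[OF integrable_mult_right[OF integrable_abs[OF Wr], of L]])
      (auto intro!: AE_I2 intro: order_trans[OF _ abs_ge_self])
  have "\<bar>\<integral>x. f (W x) * r (W x) \<partial>M\<bar> \<le> (\<integral>x. \<bar>f (W x) * r (W x)\<bar> \<partial>M)" by simp
  also have "\<dots> \<le> (\<integral>x. L * \<bar>W x * r (W x)\<bar> \<partial>M)"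
    using bd fr Wr by (intro integral_mono) auto
  finally show "\<bar>\<integral>x. f (W x) * r (W x) \<partial>M\<bar> \<le> L * (\<integral>x. \<bar>W x * r (W x)\<bar> \<partial>M)" by simp
  have fW: "integrable M (\<lambda>x. f (W x))"
    using fB by (intro integrable_const_bound[of _ B]) auto
  note c = cond_exp_mult[OF assms(1) fB diff_integrable]
  have i2: "integrable M (\<lambda>x. f (W' x) * (W x - W' x))"
    using fB by (intro Bochner_Integration.integrable_bound[OF integrable_mult_right[OF diff_integrable, of B]])
      (auto simp: abs_mult intro!: mult_mono AE_I2 order_trans[OF fB abs_ge_self])
  show i: "integrable M (\<lambda>x. (W x - W' x) * (f (W x) - f (W' x)))"
    using Bochner_Integration.integrable_diff[OF c(1) i2] by (simp add: algebra_simps)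
  have 1: "(\<integral>x. (W x - W' x) * (f (W x) - f (W' x)) \<partial>M)
      = (\<integral>x. f (W x) * (W x - W' x) \<partial>M) - (\<integral>x. f (W' x) * (W x - W' x) \<partial>M)"
    using Bochner_Integration.integral_diff[OF c(1) i2] by (simp add: algebra_simps)
  have "(\<integral>x. f (W' x) * (W x - W' x) \<partial>M) = (\<integral>x. f (W x) * (W' x - W x) \<partial>M)"
    by (rule exchange_integral[of "\<lambda>a b. f b * (a - b)"]) measurable
  also have "\<dots> = - (\<integral>x. f (W x) * (W x - W' x) \<partial>M)"
    by (subst Bochner_Integration.integral_minus[symmetric]) (simp add: algebra_simps)
  finally have 2: "(\<integral>x. f (W' x) * (W x - W' x) \<partial>M) = - (\<integral>x. f (W x) * (W x - W' x) \<partial>M)" .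
  have "(\<integral>x. f (W x) * (W x - W' x) \<partial>M)
      = (\<integral>x. f (W x) * real_cond_exp M (sigma_of M W) (\<lambda>x. W x - W' x) x \<partial>M)"
    using c(3) by simp
  also have "\<dots> = (\<integral>x. f (W x) / c0 + f (W x) * r (W x) \<partial>M)"
  proof (rule integral_cong_AE)
    show "AE x in M. f (W x) * real_cond_exp M (sigma_of M W) (\<lambda>x. W x - W' x) x
       = f (W x) / c0 + f (W x) * r (W x)"
      using regression by eventually_elim (simp add: algebra_simps)
  qed (use c(2) in auto)
  also have "\<dots> = (\<integral>x. f (W x) \<partial>M) / c0 + (\<integral>x. f (W x) * r (W x) \<partial>M)"
    using fW fr by simp
  finally have 3: "(\<integral>x. f (W x) * (W x - W' x) \<partial>M)
      = (\<integral>x. f (W x) \<partial>M) / c0 + (\<integral>x. f (W x) * r (W x) \<partial>M)" .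
  show "c0 / 2 * (\<integral>x. (W x - W' x) * (f (W x) - f (W' x)) \<partial>M)
       = (\<integral>x. f (W x) \<partial>M) + c0 * (\<integral>x. f (W x) * r (W x) \<partial>M)"
    unfolding 1 2 3 using c0 by (simp add: distrib_left)
qed

text \<open>Here \<open>\<phi>\<close> takes the place of the derivative of \<open>f\<close>, but
  differentiability is not assumed: \<open>R\<close> measures how well \<open>\<phi>\<close>
  linearises \<open>f\<close> along the pair. This leaves room for a \<open>\<phi>\<close> with a
  jump.\<close>

lemma stein_bound:
  fixes f \<phi> :: "real \<Rightarrow> real"
  assumes f: "f \<in> borel_measurable borel" and \<phi>[measurable]: "\<phi> \<in> borel_measurable borel"
    and fB: "\<And>w. \<bar>f w\<bar> \<le> B" and fL: "\<And>w. \<bar>f w\<bar> \<le> L * \<bar>w\<bar>" and \<phi>L: "\<And>w. \<bar>\<phi> w\<bar> \<le> L"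
    and sq: "integrable M (\<lambda>x. (W x - W' x)\<^sup>2)"
    and rem: "\<bar>\<integral>x. (W x - W' x) * (f (W x) - f (W' x)) - \<phi> (W x) * (W x - W' x)\<^sup>2 \<partial>M\<bar> \<le> R"
  shows "\<bar>(\<integral>x. \<phi> (W x) - f (W x) \<partial>M)\<bar>
     \<le> L * second_moment_defect + c0 / 2 * R + L * c0 * (\<integral>x. \<bar>W x * r (W x)\<bar> \<partial>M)"
proof -
  note s = stein_identity[OF f fB fL] and c = cond_exp_mult[OF \<phi> \<phi>L sq]
  let ?E = "real_cond_exp M (sigma_of M W) (\<lambda>x. (W x - W' x)\<^sup>2)"
  have fW: "integrable M (\<lambda>x. f (W x))"
    using f fB by (intro integrable_const_bound[of _ B]) auto
  have \<phi>W: "integrable M (\<lambda>x. \<phi> (W x))"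
    using \<phi>L by (intro integrable_const_bound[of _ L]) auto
  have E: "integrable M ?E" using sq by (intro real_cond_exp_int)
  have eq: "(\<integral>x. \<phi> (W x) * (1 - c0 / 2 * ?E x) \<partial>M)
     = (\<integral>x. \<phi> (W x) \<partial>M) - c0 / 2 * (\<integral>x. \<phi> (W x) * (W x - W' x)\<^sup>2 \<partial>M)"
  proof -
    have "(\<integral>x. \<phi> (W x) * (1 - c0 / 2 * ?E x) \<partial>M) = (\<integral>x. \<phi> (W x) - c0 / 2 * (\<phi> (W x) * ?E x) \<partial>M)"
      by (simp add: algebra_simps)
    also have "\<dots> = (\<integral>x. \<phi> (W x) \<partial>M) - c0 / 2 * (\<integral>x. \<phi> (W x) * ?E x \<partial>M)"
      using \<phi>W c(2) by simp
    finally show ?thesis using c(3) by simp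
  qed
  have "\<bar>\<integral>x. \<phi> (W x) * (1 - c0 / 2 * ?E x) \<partial>M\<bar> \<le> (\<integral>x. \<bar>\<phi> (W x) * (1 - c0 / 2 * ?E x)\<bar> \<partial>M)"
    by simp
  also have "\<dots> \<le> (\<integral>x. L * \<bar>1 - c0 / 2 * ?E x\<bar> \<partial>M)"
  proof (rule integral_mono)
    have "integrable M (\<lambda>x. \<phi> (W x) - c0 / 2 * (\<phi> (W x) * ?E x))"
      using \<phi>W c(2) by simp
    then show "integrable M (\<lambda>x. \<bar>\<phi> (W x) * (1 - c0 / 2 * ?E x)\<bar>)"
      by (intro integrable_abs) (simp add: algebra_simps)
    show "\<bar>\<phi> (W x) * (1 - c0 / 2 * ?E x)\<bar> \<le> L * \<bar>1 - c0 / 2 * ?E x\<bar>" for x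
      using \<phi>L[of "W x"] by (simp add: abs_mult mult_right_mono)
  qed (use E in auto)
  finally have 1: "\<bar>\<integral>x. \<phi> (W x) * (1 - c0 / 2 * ?E x) \<partial>M\<bar> \<le> L * second_moment_defect"
    by (simp add: second_moment_defect_def)
  have 2: "\<bar>c0 / 2 * (\<integral>x. (W x - W' x) * (f (W x) - f (W' x)) - \<phi> (W x) * (W x - W' x)\<^sup>2 \<partial>M)\<bar> \<le> c0 / 2 * R"
    using rem c0 by (simp add: abs_mult)
  have 3: "\<bar>c0 * (\<integral>x. f (W x) * r (W x) \<partial>M)\<bar> \<le> L * c0 * (\<integral>x. \<bar>W x * r (W x)\<bar> \<partial>M)"
    using mult_left_mono[OF s(4), of c0] c0 by (simp add: abs_mult algebra_simps)
  \<comment> \<open>The terms with \<open>\<phi> (W x) * (W x - W' x)\<^sup>2\<close> cancel between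
    \<open>eq\<close> and the remainder, and the Stein identity converts the increments of
    \<open>f\<close> into the expectation of \<open>f(W)\<close> plus the \<open>r\<close>
    term.\<close>
  have "(\<integral>x. \<phi> (W x) - f (W x) \<partial>M) = (\<integral>x. \<phi> (W x) * (1 - c0 / 2 * ?E x) \<partial>M)
      - c0 / 2 * (\<integral>x. (W x - W' x) * (f (W x) - f (W' x)) - \<phi> (W x) * (W x - W' x)\<^sup>2 \<partial>M)
      + c0 * (\<integral>x. f (W x) * r (W x) \<partial>M)"
    unfolding eq Bochner_Integration.integral_diff[OF s(2) c(1)] Bochner_Integration.integral_diff[OF \<phi>W fW]
    unfolding right_diff_distrib[of "c0 / 2"] s(3) by simp
  then show ?thesis using 1 2 3 by linarith
qed

end

subsection \<open>Lipschitz test functions\<close>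

context prob_space
begin

text \<open>A non-integrable function has integral 0 by convention, whereas the mean is known to be
  1.\<close>

lemma exponential_distributed_integrable:
  assumes D: "distributed M lborel Y (exponential_density 1)"
  shows "integrable M Y"
proof (rule ccontr)
  assume "\<not> integrable M Y"
  then have "expectation Y = 0" by (rule not_integrable_integral_eq)
  then show False using exponential_distributed_expectation[OF _ D] by simp
qed

lemma exponential_distributed_expectation_abs:
  assumes D: "distributed M lborel Y (exponential_density 1)"
  shows "(\<integral>y. \<bar>Y y\<bar> \<partial>M) = 1"
proof -
  have "(\<integral>y. \<bar>Y y\<bar> \<partial>M) = (\<integral>x. exponential_density 1 x * \<bar>x\<bar> \<partial>lborel)"
    using distributed_integral[OF D, of abs] by (simp add: exponential_density_nonneg)
  also have "\<dots> = (\<integral>x. exponential_density 1 x * x \<partial>lborel)"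
    by (intro Bochner_Integration.integral_cong) (auto simp: exponential_density_def)
  also have "\<dots> = expectation Y"
    using distributed_integral[OF D, of "\<lambda>x. x"] by (simp add: exponential_density_nonneg)
  finally show ?thesis using exponential_distributed_expectation[OF _ D] by simp
qed

text \<open>With \<open>k(t) = exp(-t) h(t)\<close>, the expectation of \<open>h(w + Y)\<close> is
  \<open>exp w\<close> times the integral of \<open>k\<close> over \<open>{w..}\<close>; the product
  rule and the fundamental theorem of calculus finish. Writing \<open>H\<close> for the smoothed
  function, \<open>H' = H - h\<close> says that \<open>f = H(0) - H\<close> solves
  \<open>f' - f = h - H(0)\<close>.\<close>

lemma exponential_smoothing_derivative:
  fixes h :: "real \<Rightarrow> real"
  assumes D: "distributed M lborel Y (exponential_density 1)"
    and cont: "continuous_on UNIV h" and hB: "\<And>x. \<bar>h x\<bar> \<le> B"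
  shows "((\<lambda>w. \<integral>y. h (w + Y y) \<partial>M) has_real_derivative (\<integral>y. h (w + Y y) \<partial>M) - h w) (at w)"
proof -
  have Y[measurable]: "Y \<in> borel_measurable M" using D by (auto simp: distributed_def)
  have [measurable]: "h \<in> borel_measurable borel" using cont by (rule borel_measurable_continuous_onI)
  define k where "k = (\<lambda>t. exp (- t) * h t)"
  have shift: "exponential_density 1 (t - v) * h t = exp v * (indicator {v..} t *\<^sub>R k t)" for v t
    by (auto simp: exponential_density_def k_def indicator_def simp flip: exp_add)
  have int: "set_integrable lborel {v..} k" for v
  proof -
    have "integrable M (\<lambda>y. h (v + Y y))"
      using hB by (intro integrable_const_bound[of _ B]) auto
    then have "integrable lborel (\<lambda>x. exponential_density 1 x * h (v + x))"
      using distributed_integrable[OF D, of "\<lambda>x. h (v + x)"] by (simp add: exponential_density_nonneg)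
    then have "integrable lborel (\<lambda>t. exponential_density 1 (t - v) * h t)"
      using lborel_integrable_real_affine_iff[of 1 "\<lambda>t. exponential_density 1 (t - v) * h t" v] by simp
    then show ?thesis unfolding shift set_integrable_def by simp
  qed
  have H: "(\<integral>y. h (v + Y y) \<partial>M) = exp v * (LINT t:{v..}|lborel. k t)" for v
  proof -
    have "(\<integral>y. h (v + Y y) \<partial>M) = (\<integral>x. exponential_density 1 x * h (v + x) \<partial>lborel)"
      using distributed_integral[OF D, of "\<lambda>x. h (v + x)"] by (simp add: exponential_density_nonneg)
    also have "\<dots> = (\<integral>t. exponential_density 1 (t - v) * h t \<partial>lborel)"
      using lborel_integral_real_affine[of 1 "\<lambda>t. exponential_density 1 (t - v) * h t" v] by simp
    finally show ?thesis unfolding shift set_lebesgue_integral_def by simp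
  qed
  have ck: "continuous_on UNIV k"
    unfolding k_def by (intro continuous_intros cont)
  \<comment> \<open>The tail beyond \<open>w + 1\<close> does not change while \<open>v\<close>
    stays within distance 1 of \<open>w\<close>, so only an integral over a compact interval has to
    be differentiated in its lower limit.\<close>
  define c where "c = (LINT t:{w + 1<..}|lborel. k t)"
  have split: "(LINT t:{v..}|lborel. k t) = integral {v..w + 1} k + c" if "v \<in> {w - 1<..<w + 1}" for v
  proof -
    have U: "{v..} = {v..w + 1} \<union> {w + 1<..}" using that by auto
    have i: "set_integrable lborel {v..w + 1} k" "set_integrable lborel {w + 1<..} k"
      by (rule set_integrable_subset[OF int[of v]]; use that in auto)+
    show ?thesis unfolding U c_def
      by (subst set_integral_Un[OF _ i]) (auto simp: set_borel_integral_eq_integral(2)[OF i(1)])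
  qed
  have "((\<lambda>v. integral {v..w + 1} k) has_real_derivative - k w) (at w within {w - 1..w + 1})"
    using continuous_on_subset[OF ck] by (intro integral_has_real_derivative') auto
  then have dI: "((\<lambda>v. integral {v..w + 1} k) has_real_derivative - k w) (at w)"
    by (simp add: at_within_Icc_at)
  have "((\<lambda>v. exp v * (integral {v..w + 1} k + c)) has_real_derivative
      exp w * (integral {w..w + 1} k + c) - h w) (at w)"
    by (rule derivative_eq_intros dI refl)+ (simp add: k_def algebra_simps flip: exp_add)
  then have "((\<lambda>v. exp v * (integral {v..w + 1} k + c)) has_real_derivative
      (\<integral>y. h (w + Y y) \<partial>M) - h w) (at w)"
    by (simp add: H split)
  then show ?thesis
    by (rule has_field_derivative_transform_within_open[where S="{w - 1<..<w + 1}"]) (auto simp: H split)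
qed

end

lemma lipschitz_imp_continuous_measurable:
  fixes h :: "real \<Rightarrow> real"
  assumes "\<And>x y. \<bar>h x - h y\<bar> \<le> L * \<bar>x - y\<bar>"
  shows "continuous_on UNIV h" and "h \<in> borel_measurable borel"
proof -
  have "0 \<le> L" using assms[of 1 0] by simp
  then have "L-lipschitz_on UNIV h" using assms by (auto intro!: lipschitz_onI simp: dist_real_def)
  then show "continuous_on UNIV h" by (rule lipschitz_on_continuous_on)
  then show "h \<in> borel_measurable borel" by (rule borel_measurable_continuous_onI)
qed

text \<open>By the mean value theorem the left-hand side is \<open>(a - b)\<^sup>2\<close> times the
  change of \<open>f'\<close> from \<open>a\<close> to an intermediate point. With
  \<open>K = 2 * L\<close> and the later prefactor \<open>c0 / 2\<close>, the constant
  \<open>K\<close> yields exactly the coefficient \<open>L * c0\<close> of the third moment.\<close>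

lemma taylor_remainder_lipschitz_derivative:
  fixes f f' :: "real \<Rightarrow> real"
  assumes f: "\<And>x. (f has_real_derivative f' x) (at x)"
    and lip: "\<And>x y. \<bar>f' x - f' y\<bar> \<le> K * \<bar>x - y\<bar>"
  shows "\<bar>(a - b) * (f a - f b) - f' a * (a - b)\<^sup>2\<bar> \<le> K * \<bar>a - b\<bar> ^ 3"
proof -
  have K: "0 \<le> K" using lip[of 1 0] by simp
  have "\<exists>\<xi>. f a - f b = (a - b) * f' \<xi> \<and> \<bar>\<xi> - a\<bar> \<le> \<bar>a - b\<bar>"
  proof (cases a b rule: linorder_cases)
    case less
    then obtain z where "z > a" "z < b" "f b - f a = (b - a) * f' z"
      using MVT2[of a b f f'] f by blast
    then show ?thesis by (intro exI[of _ z]) (auto simp: algebra_simps)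
  next
    case greater
    then obtain z where "z > b" "z < a" "f a - f b = (a - b) * f' z"
      using MVT2[of b a f f'] f by blast
    then show ?thesis by (intro exI[of _ z]) auto
  qed auto
  then obtain \<xi> where \<xi>: "f a - f b = (a - b) * f' \<xi>" "\<bar>\<xi> - a\<bar> \<le> \<bar>a - b\<bar>" by blast
  have "\<bar>(a - b) * (f a - f b) - f' a * (a - b)\<^sup>2\<bar> = (a - b)\<^sup>2 * \<bar>f' \<xi> - f' a\<bar>"
  proof -
    have "(a - b) * (f a - f b) - f' a * (a - b)\<^sup>2 = (a - b)\<^sup>2 * (f' \<xi> - f' a)"
      unfolding \<xi> by (simp add: power2_eq_square algebra_simps)
    then show ?thesis by (simp add: abs_mult)
  qed
  also have "\<dots> \<le> (a - b)\<^sup>2 * (K * \<bar>a - b\<bar>)"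
    using lip[of \<xi> a] mult_left_mono[OF \<xi>(2) K] by (intro mult_left_mono) auto
  also have "\<dots> = \<bar>a - b\<bar>\<^sup>2 * (K * \<bar>a - b\<bar>)" by simp
  also have "\<dots> = K * \<bar>a - b\<bar> ^ 3"
    by (simp only: power3_eq_cube power2_eq_square mult_ac)
  finally show ?thesis .
qed

text \<open>Dominated convergence: \<open>h\<close> grows at most linearly, so \<open>h(V)\<close>
  is integrable and dominates its clipped versions, and at any fixed value the clipping eventually
  has no effect.\<close>

lemma (in prob_space) clipped_expectation_tendsto:
  fixes h :: "real \<Rightarrow> real" and V :: "'a \<Rightarrow> real"
  assumes lip: "\<And>x y. \<bar>h x - h y\<bar> \<le> L * \<bar>x - y\<bar>" and V: "integrable M V"
  shows "(\<lambda>n. \<integral>x. max (- real n) (min (real n) (h (V x))) \<partial>M) \<longlonglongrightarrow> (\<integral>x. h (V x) \<partial>M)"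
proof (rule integral_dominated_convergence)
  have [measurable]: "V \<in> borel_measurable M" using V by auto
  note [measurable] = lipschitz_imp_continuous_measurable(2)[OF lip]
  show hV: "(\<lambda>x. h (V x)) \<in> borel_measurable M" by measurable
  show "(\<lambda>x. max (- real n) (min (real n) (h (V x)))) \<in> borel_measurable M" for n by measurable
  have b: "\<bar>h t\<bar> \<le> \<bar>\<bar>h 0\<bar> + L * \<bar>t\<bar>\<bar>" for t using lip[of t 0] by auto
  have "integrable M (\<lambda>x. h (V x))"
  proof (rule Bochner_Integration.integrable_bound)
    show "integrable M (\<lambda>x. \<bar>h 0\<bar> + L * \<bar>V x\<bar>)" using V by simp
    show "AE x in M. norm (h (V x)) \<le> norm (\<bar>h 0\<bar> + L * \<bar>V x\<bar>)" using b by simp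
  qed (rule hV)
  then show "integrable M (\<lambda>x. \<bar>h (V x)\<bar>)" by simp
  have "(\<lambda>n. max (- real n) (min (real n) t)) \<longlonglongrightarrow> t" for t
  proof (rule tendsto_eventually)
    obtain m where "\<bar>t\<bar> \<le> real m" using real_arch_simple by blast
    then show "eventually (\<lambda>n. max (- real n) (min (real n) t) = t) sequentially"
      unfolding eventually_sequentially by (intro exI[of _ m]) auto
  qed
  then show "AE x in M. (\<lambda>n. max (- real n) (min (real n) (h (V x)))) \<longlonglongrightarrow> h (V x)" by simp
  show "AE x in M. norm (max (- real n) (min (real n) (h (V x)))) \<le> \<bar>h (V x)\<bar>" for n
    by (auto intro!: AE_I2)
qed

section \<open>Stein bounds for bounded and for general Lipschitz functions\<close>

context stein_exponential_pair
begin

text \<open>Boundedness of \<open>h\<close> makes the Stein solution \<open>f\<close> bounded, as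
  the Stein identity requires. The bound itself does not involve \<open>B\<close>, which allows
  \<open>B\<close> to grow afterwards.\<close>

lemma bounded_lipschitz_bound:
  fixes N :: "'b measure" and Y :: "'b \<Rightarrow> real" and h :: "real \<Rightarrow> real"
  assumes N: "prob_space N" and D: "distributed N lborel Y (exponential_density 1)"
    and lip: "\<And>x y. \<bar>h x - h y\<bar> \<le> L * \<bar>x - y\<bar>" and hB: "\<And>x. \<bar>h x\<bar> \<le> B"
    and cube: "integrable M (\<lambda>x. \<bar>W x - W' x\<bar> ^ 3)"
  shows "\<bar>(\<integral>x. h (W x) \<partial>M) - (\<integral>y. h (Y y) \<partial>N)\<bar>
    \<le> L * (second_moment_defect + c0 * (\<integral>x. \<bar>W x - W' x\<bar> ^ 3 \<partial>M) + c0 * (\<integral>x. \<bar>W x * r (W x)\<bar> \<partial>M))"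
proof -
  interpret N: prob_space N by (rule N)
  have [measurable]: "Y \<in> borel_measurable N" using D by (auto simp: distributed_def)
  note hc = lipschitz_imp_continuous_measurable[OF lip]
  note [measurable] = hc(2)
  define H where "H w = (\<integral>y. h (w + Y y) \<partial>N)" for w
  define f \<phi> where "f w = H 0 - H w" and "\<phi> w = h w - H w" for w
  have hi: "integrable N (\<lambda>y. h (w + Y y))" for w
    using hB by (intro N.integrable_const_bound[of _ B]) auto
  have Hlip: "\<bar>H v - H w\<bar> \<le> L * \<bar>v - w\<bar>" for v w
  proof -
    have l: "\<bar>h (v + Y y) - h (w + Y y)\<bar> \<le> L * \<bar>v - w\<bar>" for y
      using lip[of "v + Y y" "w + Y y"] by simp
    have "\<bar>H v - H w\<bar> = \<bar>\<integral>y. h (v + Y y) - h (w + Y y) \<partial>N\<bar>"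
      unfolding H_def by (simp add: Bochner_Integration.integral_diff[OF hi hi])
    also have "\<dots> \<le> (\<integral>y. \<bar>h (v + Y y) - h (w + Y y)\<bar> \<partial>N)" by simp
    also have "\<dots> \<le> (\<integral>y. L * \<bar>v - w\<bar> \<partial>N)"
      using l hi by (intro integral_mono) auto
    finally show ?thesis by (simp add: N.prob_space)
  qed
  \<comment> \<open>The shift \<open>Y\<close> has absolute mean 1, so smoothing moves
    \<open>h\<close> by at most \<open>L\<close>.\<close>
  have Hh: "\<bar>h w - H w\<bar> \<le> L" for w
  proof -
    have l: "\<bar>h w - h (w + Y y)\<bar> \<le> L * \<bar>Y y\<bar>" for y
      using lip[of w "w + Y y"] by simp
    have "\<bar>h w - H w\<bar> = \<bar>\<integral>y. h w - h (w + Y y) \<partial>N\<bar>"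
      unfolding H_def using hi by (simp add: N.prob_space)
    also have "\<dots> \<le> (\<integral>y. \<bar>h w - h (w + Y y)\<bar> \<partial>N)" by simp
    also have "\<dots> \<le> (\<integral>y. L * \<bar>Y y\<bar> \<partial>N)"
      using l hi N.exponential_distributed_integrable[OF D]
      by (intro integral_mono) auto
    finally show ?thesis by (simp add: N.exponential_distributed_expectation_abs[OF D])
  qed
  have HB: "\<bar>H w\<bar> \<le> B" for w
  proof -
    have "\<bar>H w\<bar> \<le> (\<integral>y. \<bar>h (w + Y y)\<bar> \<partial>N)" unfolding H_def by simp
    also have "\<dots> \<le> (\<integral>y. B \<partial>N)" using hB hi by (intro integral_mono) auto
    finally show ?thesis by (simp add: N.prob_space)
  qed
  have [measurable]: "H \<in> borel_measurable borel" by (rule lipschitz_imp_continuous_measurable(2)[OF Hlip])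
  have der: "(f has_real_derivative \<phi> w) (at w)" for w
  proof -
    have "(H has_real_derivative H w - h w) (at w)"
      unfolding H_def by (rule N.exponential_smoothing_derivative[OF D hc(1) hB])
    then show ?thesis unfolding f_def \<phi>_def by (auto intro!: derivative_eq_intros)
  qed
  have \<phi>lip: "\<bar>\<phi> v - \<phi> w\<bar> \<le> (2 * L) * \<bar>v - w\<bar>" for v w
    using lip[of v w] Hlip[of v w] unfolding \<phi>_def by linarith
  have sq: "integrable M (\<lambda>x. (W x - W' x)\<^sup>2)"
  proof (rule Bochner_Integration.integrable_bound)
    show "integrable M (\<lambda>x. 1 + \<bar>W x - W' x\<bar> ^ 3)" using cube by simp
    have "t\<^sup>2 \<le> 1 + t ^ 3" if "t \<ge> 0" for t :: real
    proof (cases "t \<le> 1")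
      case True
      then have "t\<^sup>2 \<le> 1" using that by (simp add: power_le_one)
      then show ?thesis using that by (smt (verit) zero_le_power)
    next
      case False
      then have "t ^ 2 \<le> t ^ 3" by (intro power_increasing) auto
      then show ?thesis by simp
    qed
    from this[OF abs_ge_zero] show "AE x in M. norm ((W x - W' x)\<^sup>2) \<le> norm (1 + \<bar>W x - W' x\<bar> ^ 3)"
      by (auto intro!: AE_I2 simp: abs_of_nonneg add_nonneg_nonneg)
  qed simp
  have rem: "\<bar>\<integral>x. (W x - W' x) * (f (W x) - f (W' x)) - \<phi> (W x) * (W x - W' x)\<^sup>2 \<partial>M\<bar>
      \<le> 2 * L * (\<integral>x. \<bar>W x - W' x\<bar> ^ 3 \<partial>M)"
  proof -
    have "\<bar>\<integral>x. (W x - W' x) * (f (W x) - f (W' x)) - \<phi> (W x) * (W x - W' x)\<^sup>2 \<partial>M\<bar>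
        \<le> (\<integral>x. 2 * L * \<bar>W x - W' x\<bar> ^ 3 \<partial>M)"
      using taylor_remainder_lipschitz_derivative[of f \<phi>, OF der \<phi>lip] cube
      by (intro abs_integral_le_AE) (auto simp: f_def[abs_def] \<phi>_def[abs_def])
    then show ?thesis by simp
  qed
  have "\<bar>\<integral>x. \<phi> (W x) - f (W x) \<partial>M\<bar> \<le> L * second_moment_defect
     + c0 / 2 * (2 * L * (\<integral>x. \<bar>W x - W' x\<bar> ^ 3 \<partial>M)) + L * c0 * (\<integral>x. \<bar>W x * r (W x)\<bar> \<partial>M)"
  proof (rule stein_bound[OF _ _ _ _ _ sq rem])
    show "\<bar>f w\<bar> \<le> 2 * B" for w using HB[of 0] HB[of w] unfolding f_def by linarith
    show "\<bar>f w\<bar> \<le> L * \<bar>w\<bar>" for w using Hlip[of 0 w] by (simp add: f_def)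
    show "\<bar>\<phi> w\<bar> \<le> L" for w using Hh by (simp add: \<phi>_def)
  qed (simp_all add: f_def[abs_def] \<phi>_def[abs_def])
  \<comment> \<open>In \<open>\<phi> - f\<close> the terms \<open>H w\<close> cancel and leave
    \<open>h w - H 0\<close>, where \<open>H 0\<close> is the expectation of
    \<open>h(Y)\<close>.\<close>
  moreover have "(\<integral>x. \<phi> (W x) - f (W x) \<partial>M) = (\<integral>x. h (W x) \<partial>M) - (\<integral>y. h (Y y) \<partial>N)"
  proof -
    have "integrable M (\<lambda>x. h (W x))" using hB by (intro integrable_const_bound[of _ B]) auto
    then have "(\<integral>x. h (W x) - H 0 \<partial>M) = (\<integral>x. h (W x) \<partial>M) - H 0" by (simp add: prob_space)
    then show ?thesis by (simp add: \<phi>_def f_def H_def)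
  qed
  ultimately show ?thesis by (simp add: algebra_simps)
qed

text \<open>Clipping at \<open>-n\<close> and \<open>n\<close> does not increase the Lipschitz
  constant, so the bound for bounded functions is uniform in \<open>n\<close> and passes to the
  limit.\<close>

lemma lipschitz_bound:
  fixes N :: "'b measure" and Y :: "'b \<Rightarrow> real" and h :: "real \<Rightarrow> real"
  assumes N: "prob_space N" and D: "distributed N lborel Y (exponential_density 1)"
    and lip: "\<And>x y. \<bar>h x - h y\<bar> \<le> L * \<bar>x - y\<bar>"
    and Wi: "integrable M W" and cube: "integrable M (\<lambda>x. \<bar>W x - W' x\<bar> ^ 3)"
  shows "\<bar>(\<integral>x. h (W x) \<partial>M) - (\<integral>y. h (Y y) \<partial>N)\<bar>
    \<le> L * (second_moment_defect + c0 * (\<integral>x. \<bar>W x - W' x\<bar> ^ 3 \<partial>M) + c0 * (\<integral>x. \<bar>W x * r (W x)\<bar> \<partial>M))"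
proof -
  interpret N: prob_space N by (rule N)
  have [measurable]: "Y \<in> borel_measurable N" using D by (auto simp: distributed_def)
  note [measurable] = lipschitz_imp_continuous_measurable(2)[OF lip]
  define hn where "hn n x = max (- real n) (min (real n) (h x))" for n x
  show ?thesis
  proof (rule tendsto_upperbound)
    show "(\<lambda>n. \<bar>(\<integral>x. hn n (W x) \<partial>M) - (\<integral>y. hn n (Y y) \<partial>N)\<bar>)
       \<longlonglongrightarrow> \<bar>(\<integral>x. h (W x) \<partial>M) - (\<integral>y. h (Y y) \<partial>N)\<bar>"
      unfolding hn_def
      by (intro tendsto_intros clipped_expectation_tendsto[OF lip Wi]
          N.clipped_expectation_tendsto[OF lip] N.exponential_distributed_integrable[OF D])
    show "eventually (\<lambda>n. \<bar>(\<integral>x. hn n (W x) \<partial>M) - (\<integral>y. hn n (Y y) \<partial>N)\<bar> \<le>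
      L * (second_moment_defect + c0 * (\<integral>x. \<bar>W x - W' x\<bar> ^ 3 \<partial>M) + c0 * (\<integral>x. \<bar>W x * r (W x)\<bar> \<partial>M)))
      sequentially"
    proof (intro always_eventually allI bounded_lipschitz_bound[OF N D _ _ cube])
      fix n x y
      show "\<bar>hn n x\<bar> \<le> real n" by (auto simp: hn_def)
      have "\<bar>hn n x - hn n y\<bar> \<le> \<bar>h x - h y\<bar>" unfolding hn_def by linarith
      then show "\<bar>hn n x - hn n y\<bar> \<le> L * \<bar>x - y\<bar>" using lip order_trans by blast
    qed
  qed simp
qed

end

subsection \<open>Indicators of half-lines\<close>

text \<open>For \<open>x \<le> y\<close> factor out \<open>exp (- x)\<close>, which is at most 1,
  and use \<open>1 - s \<le> exp (- s)\<close> with \<open>s = y - x\<close>.\<close>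

lemma exp_minus_lipschitz:
  fixes x y :: real
  assumes "x \<ge> 0" "y \<ge> 0"
  shows "\<bar>exp (- x) - exp (- y)\<bar> \<le> \<bar>x - y\<bar>"
proof -
  have *: "exp (- x) - exp (- y) \<le> y - x" "exp (- y) \<le> exp (- x)" if "0 \<le> x" "x \<le> y" for x y :: real
  proof -
    have "1 - (y - x) \<le> exp (- (y - x))" using exp_ge_add_one_self[of "- (y - x)"] by linarith
    then have "exp (- x) * (1 - exp (- (y - x))) \<le> 1 * (y - x)"
      using that by (intro mult_mono) auto
    then show "exp (- x) - exp (- y) \<le> y - x" by (simp add: algebra_simps flip: exp_add)
  qed (use that in auto)
  show ?thesis
    using *[of x y] *[of y x] assms by (cases "x \<le> y") auto
qed

section \<open>Explicit Stein solution for a half-line\<close>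

context
  fixes z :: real
begin

text \<open>This is \<open>P(Y \<le> z) - P(w + Y \<le> z)\<close>, the Stein solution for the
  indicator of \<open>{..z}\<close>. The maxima make the exponential distribution function correct
  at negative arguments too.\<close>

definition stein_sol :: "real \<Rightarrow> real" where
  "stein_sol w = exp (- max (z - w) 0) - exp (- max z 0)"

text \<open>At the kink \<open>w = z\<close> the left derivative is chosen, so that the Stein
  equation with the closed half-line \<open>{..z}\<close> holds at every point.\<close>

definition stein_sol_deriv :: "real \<Rightarrow> real" where
  "stein_sol_deriv w = (if w \<le> z then exp (w - z) else 0)"

lemma stein_sol_lipschitz: "\<bar>stein_sol v - stein_sol w\<bar> \<le> \<bar>v - w\<bar>"
proof -
  have "\<bar>stein_sol v - stein_sol w\<bar> \<le> \<bar>max (z - v) 0 - max (z - w) 0\<bar>"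
    using exp_minus_lipschitz[of "max (z - v) 0" "max (z - w) 0"] by (simp add: stein_sol_def)
  also have "\<dots> \<le> \<bar>v - w\<bar>" by (auto simp: max_def)
  finally show ?thesis .
qed

lemma stein_sol_bound: "\<bar>stein_sol w\<bar> \<le> \<bar>w\<bar>" "\<bar>stein_sol w\<bar> \<le> 1"
proof -
  have "stein_sol 0 = 0" by (simp add: stein_sol_def)
  then show "\<bar>stein_sol w\<bar> \<le> \<bar>w\<bar>" using stein_sol_lipschitz[of w 0] by simp
  have "\<bar>p - q\<bar> \<le> 1" if "0 < p" "p \<le> 1" "0 < q" "q \<le> 1" for p q :: real
    using that by linarith
  then show "\<bar>stein_sol w\<bar> \<le> 1" by (simp add: stein_sol_def)
qed

lemma stein_sol_measurable[measurable]:
  "stein_sol \<in> borel_measurable borel" "stein_sol_deriv \<in> borel_measurable borel"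
  unfolding stein_sol_def[abs_def] stein_sol_deriv_def[abs_def] by measurable

lemma stein_sol_equation:
  "stein_sol_deriv w - stein_sol w = indicator {..z} w - (1 - exp (- max z 0))"
  by (auto simp: stein_sol_deriv_def stein_sol_def indicator_def max_def)

text \<open>This is the trapezoidal rule, symmetric in \<open>a\<close> and \<open>b\<close>, so
  \<open>b \<le> a\<close> may be assumed. Before multiplying by \<open>a - b\<close> the error is
  at most \<open>(a - b)\<^sup>2 / 2\<close>, plus half of \<open>a - b\<close> when the unit jump
  of the derivative lies in between.\<close>

lemma stein_sol_trapezoid:
  "\<bar>(a - b) * (stein_sol a - stein_sol b) - (stein_sol_deriv a + stein_sol_deriv b) / 2 * (a - b)\<^sup>2\<bar>
    \<le> \<bar>a - b\<bar> ^ 3 / 2 + (if min a b \<le> z \<and> z < max a b then (a - b)\<^sup>2 else 0) / 2"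
proof -
  have key: "\<bar>stein_sol a - stein_sol b - (stein_sol_deriv a + stein_sol_deriv b) / 2 * (a - b)\<bar>
      \<le> (a - b)\<^sup>2 / 2 + (if b \<le> z \<and> z < a then (a - b) / 2 else 0)" if ab: "b \<le> a" for a b
  proof -
    consider "a \<le> z" | "z < b" | "b \<le> z" "z < a" by linarith
    then show ?thesis
    proof cases
      case 1
      \<comment> \<open>By convexity of the exponential, \<open>X - Y\<close> lies between
        \<open>d * Y\<close> and \<open>d * X\<close>; the trapezoidal value is their midpoint, so
        the error is at most \<open>d * (X - Y) / 2\<close>.\<close>
      have aux: "\<bar>X - Y - (X + Y) / 2 * d\<bar> \<le> d * d / 2"
        if "X - Y \<le> d * X" "d * Y \<le> X - Y" "(X - Y) * d \<le> d * d" for X Y d :: real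
        using that by (simp add: abs_le_iff field_simps)
      let ?x = "exp (a - z)" and ?y = "exp (b - z)"
      have up: "?x - ?y \<le> (a - b) * ?x"
        using mult_left_mono[OF exp_ge_add_one_self[of "b - a"], of ?x]
        by (simp add: algebra_simps flip: exp_add)
      have lo: "(a - b) * ?y \<le> ?x - ?y"
        using mult_left_mono[OF exp_ge_add_one_self[of "a - b"], of ?y]
        by (simp add: algebra_simps flip: exp_add)
      have "?x - ?y \<le> a - b"
        using exp_minus_lipschitz[of "z - a" "z - b"] 1 ab by auto
      then have "(?x - ?y) * (a - b) \<le> (a - b) * (a - b)" using ab by (intro mult_right_mono) auto
      then have "\<bar>?x - ?y - (?x + ?y) / 2 * (a - b)\<bar> \<le> (a - b)\<^sup>2 / 2"
        using aux[OF up lo] by (simp add: power2_eq_square)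
      then show ?thesis using 1 ab by (simp add: stein_sol_def stein_sol_deriv_def)
    next
      case 2
      then show ?thesis using ab by (simp add: stein_sol_def stein_sol_deriv_def)
    next
      case 3
      \<comment> \<open>The derivative is 0 at \<open>a\<close>, so only \<open>Y\<close> enters the
        average. For the upper estimate, \<open>d - Y * d / 2\<close> equals
        \<open>d / 2 + (1 - Y) * d / 2\<close>.\<close>
      have aux: "\<bar>1 - Y - Y / 2 * d\<bar> \<le> d * d / 2 + d / 2"
        if "1 - Y \<le> d" "Y \<le> 1" "(1 - Y) * d \<le> d * d" "Y * d \<le> 1 * d" for Y d :: real
        using that zero_le_square[of d] unfolding abs_le_iff left_diff_distrib by simp
      let ?y = "exp (b - z)"
      have y: "1 + (b - z) \<le> ?y" "?y \<le> 1" "0 < ?y" using exp_ge_add_one_self[of "b - z"] 3 by auto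
      have d: "1 - ?y \<le> a - b" using y(1) 3 by linarith
      then have "(1 - ?y) * (a - b) \<le> (a - b) * (a - b)" using 3 by (intro mult_right_mono) auto
      moreover have "?y * (a - b) \<le> 1 * (a - b)" using y 3 by (intro mult_right_mono) auto
      ultimately have "\<bar>1 - ?y - ?y / 2 * (a - b)\<bar> \<le> (a - b)\<^sup>2 / 2 + (a - b) / 2"
        using aux[OF d y(2)] by (simp add: power2_eq_square)
      then show ?thesis using 3 by (simp add: stein_sol_def stein_sol_deriv_def)
    qed
  qed
  have *: "\<bar>(a - b) * (stein_sol a - stein_sol b) - (stein_sol_deriv a + stein_sol_deriv b) / 2 * (a - b)\<^sup>2\<bar>
    \<le> \<bar>a - b\<bar> ^ 3 / 2 + (if min a b \<le> z \<and> z < max a b then (a - b)\<^sup>2 else 0) / 2"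
    if ab: "b \<le> a" for a b
  proof -
    have "\<bar>(a - b) * (stein_sol a - stein_sol b) - (stein_sol_deriv a + stein_sol_deriv b) / 2 * (a - b)\<^sup>2\<bar>
      = (a - b) * \<bar>stein_sol a - stein_sol b - (stein_sol_deriv a + stein_sol_deriv b) / 2 * (a - b)\<bar>"
    proof -
      have aux: "d * p - q / 2 * d\<^sup>2 = d * (p - q / 2 * d)" for d p q :: real
        by (simp add: power2_eq_square right_diff_distrib)
      have "(a - b) * (stein_sol a - stein_sol b) - (stein_sol_deriv a + stein_sol_deriv b) / 2 * (a - b)\<^sup>2
        = (a - b) * (stein_sol a - stein_sol b - (stein_sol_deriv a + stein_sol_deriv b) / 2 * (a - b))"
        by (rule aux)
      then show ?thesis using ab by (simp add: abs_mult)
    qed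
    also have "\<dots> \<le> (a - b) * ((a - b)\<^sup>2 / 2 + (if b \<le> z \<and> z < a then (a - b) / 2 else 0))"
      using key[OF ab] ab by (intro mult_left_mono) auto
    also have "\<dots> = \<bar>a - b\<bar> ^ 3 / 2 + (if min a b \<le> z \<and> z < max a b then (a - b)\<^sup>2 else 0) / 2"
      using ab by (simp add: distrib_left power3_eq_cube power2_eq_square)
    finally show ?thesis .
  qed
  show ?thesis
  proof (cases "b \<le> a")
    case False
    then have "a \<le> b" by simp
    have "(b - a) * (stein_sol b - stein_sol a) = (a - b) * (stein_sol a - stein_sol b)" by algebra
    then show ?thesis
      using *[OF \<open>a \<le> b\<close>]
      by (simp only: power2_commute[of b a] abs_minus_commute[of b a] min.commute[of b a]
          max.commute[of b a] add.commute[of "stein_sol_deriv b"])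
  qed (rule *)
qed

end

text \<open>For negative \<open>z\<close> both sides are 0, by monotonicity from the case
  \<open>z = 0\<close>.\<close>

lemma exponential_cdf:
  assumes "prob_space N" and D: "distributed N lborel Y (exponential_density 1)"
  shows "measure N {y \<in> space N. Y y \<le> z} = 1 - exp (- max z 0)"
proof -
  interpret prob_space N by fact
  have [measurable]: "Y \<in> borel_measurable N" using D by (auto simp: distributed_def)
  show ?thesis
  proof (cases "z \<ge> 0")
    case True
    then show ?thesis using exponential_distributedD_le[OF D] by simp
  next
    case False
    then have "prob {y \<in> space N. Y y \<le> z} \<le> prob {y \<in> space N. Y y \<le> 0}"
      by (intro finite_measure_mono) auto
    also have "\<dots> = 0" using exponential_distributedD_le[OF D, of 0] by simp
    finally show ?thesis using False by (simp add: measure_le_0_iff)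
  qed
qed

section \<open>Crossings of the level and the Kolmogorov distance\<close>

context stein_exponential_pair
begin

text \<open>The test function is a truncation of \<open>w - z\<close>, shifted to vanish at \<open>0\<close> so that its
  product with \<open>r\<close> is controlled by \<open>W r(W)\<close> alone.\<close>

lemma crossing_bound:
  assumes bd: "AE x in M. \<bar>W x - W' x\<bar> \<le> \<delta>" and \<delta>: "0 \<le> \<delta>"
  obtains g where "g \<in> borel_measurable borel"
    and "integrable M (\<lambda>x. (W x - W' x) * (g (W x) - g (W' x)))"
    and "AE x in M. (if min (W x) (W' x) \<le> z \<and> z < max (W x) (W' x) then (W x - W' x)\<^sup>2 else 0)
       \<le> (W x - W' x) * (g (W x) - g (W' x))"
    and "c0 / 2 * (\<integral>x. (W x - W' x) * (g (W x) - g (W' x)) \<partial>M)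
       \<le> 2 * \<delta> + c0 * (\<integral>x. \<bar>W x * r (W x)\<bar> \<partial>M)"
proof -
  define clip where "clip t = max (- \<delta>) (min \<delta> t)" for t
  define g where "g w = clip (w - z) - clip (- z)" for w
  have clip_bound: "\<bar>clip t\<bar> \<le> \<delta>" for t
    using \<delta> by (auto simp: clip_def)
  have clip_lipschitz: "\<bar>clip s - clip t\<bar> \<le> \<bar>s - t\<bar>" for s t
    unfolding clip_def by linarith
  have clip_mono: "clip s \<le> clip t" if "s \<le> t" for s t
    unfolding clip_def using that by (intro max.mono min.mono) auto
  have clip_id: "clip t = t" if "\<bar>t\<bar> \<le> \<delta>" for t
    using that by (auto simp: clip_def)
  have g1: "\<bar>g w\<bar> \<le> 2 * \<delta>" "\<bar>g w\<bar> \<le> 1 * \<bar>w\<bar>" for w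
    using clip_bound[of "w - z"] clip_bound[of "- z"] clip_lipschitz[of "w - z" "- z"]
    by (auto simp: g_def)
  have gm[measurable]: "g \<in> borel_measurable borel" unfolding g_def[abs_def] clip_def by measurable
  note s = stein_identity[OF gm g1]
  \<comment> \<open>If \<open>z\<close> separates \<open>a\<close> and \<open>b\<close>, both are
    within \<open>\<delta>\<close> of \<open>z\<close>, where the truncation is the identity and
    \<open>g\<close> has slope 1. Otherwise monotonicity of \<open>g\<close> suffices.\<close>
  have cross: "(if min a b \<le> z \<and> z < max a b then (a - b)\<^sup>2 else 0) \<le> (a - b) * (g a - g b)"
    if "\<bar>a - b\<bar> \<le> \<delta>" for a b
  proof (cases "min a b \<le> z \<and> z < max a b")
    case True
    then have "\<bar>a - z\<bar> \<le> \<delta>" "\<bar>b - z\<bar> \<le> \<delta>" using that by (auto simp: min_def max_def split: if_splits)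
    then have "g a - g b = a - b" by (simp add: g_def clip_id)
    then show ?thesis by (simp add: power2_eq_square)
  next
    case False
    have "0 \<le> (a - b) * (g a - g b)"
    proof (cases "b \<le> a")
      case True
      then have "g b \<le> g a" by (simp add: g_def clip_mono)
      then show ?thesis using True by simp
    next
      case False
      then have "g a \<le> g b" by (simp add: g_def clip_mono)
      then show ?thesis using False by (simp add: mult_nonpos_nonpos)
    qed
    then show ?thesis unfolding if_not_P[OF False] .
  qed
  have "(\<integral>x. g (W x) \<partial>M) \<le> (\<integral>x. 2 * \<delta> \<partial>M)"
  proof (rule integral_mono)
    show "integrable M (\<lambda>x. g (W x))"
      using g1 by (intro integrable_const_bound[of _ "2 * \<delta>"]) auto
    show "g (W x) \<le> 2 * \<delta>" for x using g1(1)[of "W x"] by linarith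
  qed simp
  moreover have "c0 * (\<integral>x. g (W x) * r (W x) \<partial>M) \<le> c0 * (\<integral>x. \<bar>W x * r (W x)\<bar> \<partial>M)"
    using s(4) c0 by (intro mult_left_mono) auto
  ultimately have gb: "c0 / 2 * (\<integral>x. (W x - W' x) * (g (W x) - g (W' x)) \<partial>M)
       \<le> 2 * \<delta> + c0 * (\<integral>x. \<bar>W x * r (W x)\<bar> \<partial>M)"
    using s(3) by (simp add: prob_space)
  have "AE x in M. (if min (W x) (W' x) \<le> z \<and> z < max (W x) (W' x) then (W x - W' x)\<^sup>2 else 0)
       \<le> (W x - W' x) * (g (W x) - g (W' x))"
    using bd by eventually_elim (rule cross)
  then show ?thesis by (rule that[OF gm s(2) _ gb])
qed

text \<open>The trapezoidal estimate leaves the remainder \<open>\<delta> ^ 3 / 2\<close> plus half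
  of the crossing integral. After the prefactor \<open>c0 / 2\<close>, the first gives
  \<open>c0 / 4 * \<delta> ^ 3\<close> and the second at most \<open>\<delta>\<close> plus
  \<open>c0 / 2\<close> times the expectation of \<open>|W r(W)|\<close>; the latter joins the
  \<open>c0\<close> multiple from \<open>stein_bound\<close> to make \<open>3 / 2\<close>.\<close>

lemma kolmogorov_bound:
  fixes N :: "'b measure" and Y :: "'b \<Rightarrow> real"
  assumes N: "prob_space N" and D: "distributed N lborel Y (exponential_density 1)"
    and bd: "AE x in M. \<bar>W x - W' x\<bar> \<le> \<delta>"
  shows "\<bar>measure M {x \<in> space M. W x \<le> z} - measure N {y \<in> space N. Y y \<le> z}\<bar>
    \<le> second_moment_defect + \<delta> + c0 / 4 * \<delta> ^ 3 + 3 / 2 * c0 * (\<integral>x. \<bar>W x * r (W x)\<bar> \<partial>M)"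
proof -
  have "AE x in M. 0 \<le> \<delta>" using bd by eventually_elim linarith
  then have \<delta>: "0 \<le> \<delta>" by simp
  let ?f = "stein_sol z" and ?\<phi> = "stein_sol_deriv z"
  let ?F = "1 - exp (- max z 0)"
  have \<phi>1: "\<bar>?\<phi> w\<bar> \<le> 1" for w by (simp add: stein_sol_deriv_def)
  have f1: "\<bar>?f w\<bar> \<le> 1" "\<bar>?f w\<bar> \<le> 1 * \<bar>w\<bar>" for w using stein_sol_bound by simp_all
  have sq: "integrable M (\<lambda>x. (W x - W' x)\<^sup>2)"
  proof (rule integrable_const_bound[of _ "\<delta>\<^sup>2"])
    show "AE x in M. norm ((W x - W' x)\<^sup>2) \<le> \<delta>\<^sup>2"
      using bd by eventually_elim (use \<delta> in \<open>simp add: abs_le_square_iff[symmetric]\<close>)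
  qed simp
  obtain g where [measurable]: "g \<in> borel_measurable borel"
    and gi: "integrable M (\<lambda>x. (W x - W' x) * (g (W x) - g (W' x)))" (is "integrable M ?G")
    and cross: "AE x in M. (if min (W x) (W' x) \<le> z \<and> z < max (W x) (W' x) then (W x - W' x)\<^sup>2 else 0)
       \<le> (W x - W' x) * (g (W x) - g (W' x))"
    and gb: "c0 / 2 * (\<integral>x. (W x - W' x) * (g (W x) - g (W' x)) \<partial>M)
       \<le> 2 * \<delta> + c0 * (\<integral>x. \<bar>W x * r (W x)\<bar> \<partial>M)"
    using crossing_bound[OF bd \<delta>, of z] by blast
  note si = stein_identity(2)[OF stein_sol_measurable(1) f1]
    and i1 = cond_exp_mult(1)[OF stein_sol_measurable(2) \<phi>1 sq]
  have i2: "integrable M (\<lambda>x. ?\<phi> (W' x) * (W x - W' x)\<^sup>2)"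
    using mult_right_mono[OF \<phi>1 zero_le_power2]
    by (intro Bochner_Integration.integrable_bound[OF sq]) (auto simp: abs_mult)
  have sym: "(\<integral>x. ?\<phi> (W x) * (W x - W' x)\<^sup>2 \<partial>M) = (\<integral>x. ?\<phi> (W' x) * (W x - W' x)\<^sup>2 \<partial>M)"
    using exchange_integral[of "\<lambda>a b. ?\<phi> a * (a - b)\<^sup>2"] by (simp add: power2_commute)
  \<comment> \<open>Averaging over the exchanged pair halves the error caused by the jump of \<open>\<phi>\<close> at \<open>z\<close>.\<close>
  have "(\<integral>x. (W x - W' x) * (?f (W x) - ?f (W' x)) - ?\<phi> (W x) * (W x - W' x)\<^sup>2 \<partial>M)
    = (\<integral>x. (W x - W' x) * (?f (W x) - ?f (W' x)) - (?\<phi> (W x) + ?\<phi> (W' x)) / 2 * (W x - W' x)\<^sup>2 \<partial>M)"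
  proof -
    have "(\<integral>x. (?\<phi> (W x) + ?\<phi> (W' x)) / 2 * (W x - W' x)\<^sup>2 \<partial>M)
      = (\<integral>x. (?\<phi> (W x) * (W x - W' x)\<^sup>2 + ?\<phi> (W' x) * (W x - W' x)\<^sup>2) / 2 \<partial>M)"
      by (simp add: distrib_right add_divide_distrib)
    also have "\<dots> = (\<integral>x. ?\<phi> (W x) * (W x - W' x)\<^sup>2 \<partial>M)"
      using i1 i2 by (simp add: sym)
    finally have e: "(\<integral>x. (?\<phi> (W x) + ?\<phi> (W' x)) / 2 * (W x - W' x)\<^sup>2 \<partial>M)
      = (\<integral>x. ?\<phi> (W x) * (W x - W' x)\<^sup>2 \<partial>M)" .
    have "integrable M (\<lambda>x. (?\<phi> (W x) * (W x - W' x)\<^sup>2 + ?\<phi> (W' x) * (W x - W' x)\<^sup>2) / 2)"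
      using i1 i2 by simp
    then have i3: "integrable M (\<lambda>x. (?\<phi> (W x) + ?\<phi> (W' x)) / 2 * (W x - W' x)\<^sup>2)"
      by (simp add: distrib_right add_divide_distrib)
    show ?thesis
      unfolding Bochner_Integration.integral_diff[OF si i1] Bochner_Integration.integral_diff[OF si i3] e ..
  qed
  moreover have "\<bar>\<integral>x. (W x - W' x) * (?f (W x) - ?f (W' x)) - (?\<phi> (W x) + ?\<phi> (W' x)) / 2 * (W x - W' x)\<^sup>2 \<partial>M\<bar>
     \<le> (\<integral>x. \<delta> ^ 3 / 2 + ?G x / 2 \<partial>M)"
  proof (rule abs_integral_le_AE)
    show "AE x in M. \<bar>(W x - W' x) * (?f (W x) - ?f (W' x)) - (?\<phi> (W x) + ?\<phi> (W' x)) / 2 * (W x - W' x)\<^sup>2\<bar>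
        \<le> \<delta> ^ 3 / 2 + ?G x / 2"
      using cross bd
    proof eventually_elim
      case (elim x)
      have "\<bar>W x - W' x\<bar> ^ 3 \<le> \<delta> ^ 3" using elim(2) by (intro power_mono) auto
      then show ?case using elim(1) stein_sol_trapezoid[of "W x" "W' x" z] by linarith
    qed
  qed (use gi in auto)
  ultimately have rem: "\<bar>\<integral>x. (W x - W' x) * (?f (W x) - ?f (W' x)) - ?\<phi> (W x) * (W x - W' x)\<^sup>2 \<partial>M\<bar>
     \<le> \<delta> ^ 3 / 2 + (\<integral>x. ?G x \<partial>M) / 2"
    using gi by (simp add: prob_space)
  have "\<bar>\<integral>x. ?\<phi> (W x) - ?f (W x) \<partial>M\<bar> \<le> 1 * second_moment_defect
     + c0 / 2 * (\<delta> ^ 3 / 2 + (\<integral>x. ?G x \<partial>M) / 2) + 1 * c0 * (\<integral>x. \<bar>W x * r (W x)\<bar> \<partial>M)"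
    by (rule stein_bound[OF stein_sol_measurable f1 \<phi>1 sq rem])
  moreover have "(\<integral>x. ?\<phi> (W x) - ?f (W x) \<partial>M) = measure M {x \<in> space M. W x \<le> z} - ?F"
  proof -
    have "(\<integral>x. indicat_real {..z} (W x) \<partial>M) = measure M {x \<in> space M. W x \<le> z}"
    proof -
      have "(\<integral>x. indicat_real {..z} (W x) \<partial>M) = (\<integral>x. indicat_real {x \<in> space M. W x \<le> z} x \<partial>M)"
        by (intro Bochner_Integration.integral_cong) (auto simp: indicator_def)
      then show ?thesis by simp
    qed
    moreover have "integrable M (\<lambda>x. indicator {..z} (W x) :: real)"
      by (intro integrable_const_bound[of _ 1]) auto
    ultimately show ?thesis by (simp add: stein_sol_equation prob_space)
  qed
  ultimately show ?thesis
    using gb unfolding exponential_cdf[OF N D] by (simp add: distrib_left)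
qed

end

text \<open>\<open>W'\<close> is the first coordinate of the swapped pair, and integrability of a
  coordinate depends only on the joint law.\<close>

lemma exchangeable_integrable:
  assumes [measurable]: "W \<in> borel_measurable M" "W' \<in> borel_measurable M"
    and exch: "exchangeable M W W'" and int: "integrable M W"
  shows "integrable M W'"
proof -
  have "integrable (distr M (borel \<Otimes>\<^sub>M borel) (\<lambda>x. (W x, W' x))) (fst :: real \<times> real \<Rightarrow> real)"
    using int by (subst integrable_distr_eq) auto
  then have "integrable (distr M (borel \<Otimes>\<^sub>M borel) (\<lambda>x. (W' x, W x))) (fst :: real \<times> real \<Rightarrow> real)"
    using exch by (simp add: exchangeable_def)
  then show ?thesis by (subst (asm) integrable_distr_eq) auto
qed

section \<open>Assembly of the Lipschitz and the Kolmogorov bound\<close>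

theorem theorem3p1:
  fixes M :: "'a measure" and N :: "'b measure"
    and W W' :: "'a \<Rightarrow> real" and r :: "real \<Rightarrow> real" and c0 :: real
    and Y :: "'b \<Rightarrow> real"
  assumes "prob_space M"
    and "W \<in> borel_measurable M" and "W' \<in> borel_measurable M"
    and "exchangeable M W W'"
    and "c0 > 0"
    and "r \<in> borel_measurable borel"
    and "AE x in M. real_cond_exp M (sigma_of M W) (\<lambda>x. W x - W' x) x = 1 / c0 + r (W x)"
    and "integrable M (\<lambda>x. W x * r (W x))"
    and "prob_space N" and "distributed N lborel Y (exponential_density 1)"
  shows
   "(\<forall>h h'. abs_continuous h
        \<and> (AE x in lborel. (h has_real_derivative h' x) (at x))
        \<and> bdd_above (range (\<lambda>x. \<bar>h' x\<bar>))
        \<and> integrable M W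
        \<and> integrable M (\<lambda>x. \<bar>W x - W' x\<bar> ^ 3)
      \<longrightarrow> \<bar>(\<integral>x. h (W x) \<partial>M) - (\<integral>y. h (Y y) \<partial>N)\<bar>
          \<le> (SUP x. \<bar>h' x\<bar>) *
             ((\<integral>x. \<bar>1 - (c0 / 2) * real_cond_exp M (sigma_of M W) (\<lambda>x. (W x - W' x)\<^sup>2) x\<bar> \<partial>M)
              + c0 * (\<integral>x. \<bar>W x - W' x\<bar> ^ 3 \<partial>M)
              + 3 * c0 * (\<integral>x. \<bar>W x * r (W x)\<bar> \<partial>M)))
    \<and> (\<forall>\<delta>. (AE x in M. \<bar>W x - W' x\<bar> \<le> \<delta>) \<longrightarrow>
        (\<forall>z. \<bar>measure M {x \<in> space M. W x \<le> z} - measure N {y \<in> space N. Y y \<le> z}\<bar>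
          \<le> 3 * (\<integral>x. \<bar>1 - (c0 / 2) * real_cond_exp M (sigma_of M W) (\<lambda>x. (W x - W' x)\<^sup>2) x\<bar> \<partial>M)
             + \<delta> + 2 * c0 * \<delta> ^ 3
             + 3 * c0 * (\<integral>x. \<bar>W x * r (W x)\<bar> \<partial>M)))"
proof (intro conjI allI impI)
  fix h h' :: "real \<Rightarrow> real"
  assume A: "abs_continuous h \<and> (AE x in lborel. (h has_real_derivative h' x) (at x))
        \<and> bdd_above (range (\<lambda>x. \<bar>h' x\<bar>)) \<and> integrable M W
        \<and> integrable M (\<lambda>x. \<bar>W x - W' x\<bar> ^ 3)"
  define L where "L = (SUP x. \<bar>h' x\<bar>)"
  have hL: "\<bar>h' x\<bar> \<le> L" for x unfolding L_def using A by (intro cSUP_upper) auto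
  have L0: "0 \<le> L" using hL[of 0] by linarith
  \<comment> \<open>From here on \<open>h\<close> enters only through its Lipschitz constant
    \<open>L\<close>, the supremum of \<open>|h'|\<close>.\<close>
  have up: "\<bar>h b - h a\<bar> \<le> L * (b - a)" if "a \<le> b" for a b
    using that A hL
    by (intro lipschitz_on_interval_if_ae_bounded_derivative[where h'=h']) (auto simp: abs_continuous_def)
  have lip: "\<bar>h x - h y\<bar> \<le> L * \<bar>x - y\<bar>" for x y
    using up[of x y] up[of y x] by (cases "x \<le> y") (auto simp: abs_minus_commute)
  have "integrable M (\<lambda>x. W x - W' x)"
    using A exchangeable_integrable[OF assms(2-4)] by simp
  with assms interpret stein_exponential_pair M W W' r c0
    by (auto simp: stein_exponential_pair_def stein_exponential_pair_axioms_def)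
  have "\<bar>(\<integral>x. h (W x) \<partial>M) - (\<integral>y. h (Y y) \<partial>N)\<bar>
    \<le> L * (second_moment_defect + c0 * (\<integral>x. \<bar>W x - W' x\<bar> ^ 3 \<partial>M) + c0 * (\<integral>x. \<bar>W x * r (W x)\<bar> \<partial>M))"
    using A by (intro lipschitz_bound[OF assms(9,10) lip]) auto
  also have "\<dots> \<le> L * (second_moment_defect + c0 * (\<integral>x. \<bar>W x - W' x\<bar> ^ 3 \<partial>M)
      + 3 * c0 * (\<integral>x. \<bar>W x * r (W x)\<bar> \<partial>M))"
    using L0 c0 by (intro mult_left_mono add_left_mono mult_right_mono) auto
  finally show "\<bar>(\<integral>x. h (W x) \<partial>M) - (\<integral>y. h (Y y) \<partial>N)\<bar>
     \<le> (SUP x. \<bar>h' x\<bar>) *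
       ((\<integral>x. \<bar>1 - (c0 / 2) * real_cond_exp M (sigma_of M W) (\<lambda>x. (W x - W' x)\<^sup>2) x\<bar> \<partial>M)
        + c0 * (\<integral>x. \<bar>W x - W' x\<bar> ^ 3 \<partial>M)
        + 3 * c0 * (\<integral>x. \<bar>W x * r (W x)\<bar> \<partial>M))"
    unfolding L_def second_moment_defect_def .
next
  fix \<delta> z :: real
  assume bd: "AE x in M. \<bar>W x - W' x\<bar> \<le> \<delta>"
  interpret M: prob_space M by fact
  have "integrable M (\<lambda>x. W x - W' x)"
    using bd assms(2,3) by (intro M.integrable_const_bound[of _ \<delta>]) auto
  with assms interpret stein_exponential_pair M W W' r c0
    by (auto simp: stein_exponential_pair_def stein_exponential_pair_axioms_def)
  \<comment> \<open>Nonnegativity of \<open>\<delta>\<close> allows the coefficient of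
    \<open>\<delta> ^ 3\<close> to be enlarged from \<open>c0 / 4\<close> to
    \<open>2 * c0\<close>.\<close>
  have "AE x in M. 0 \<le> \<delta>" using bd by eventually_elim linarith
  then have "0 \<le> \<delta>" by simp
  then have "c0 / 4 * \<delta> ^ 3 \<le> 2 * c0 * \<delta> ^ 3"
    using c0 by (intro mult_right_mono) auto
  moreover have "3 / 2 * c0 * (\<integral>x. \<bar>W x * r (W x)\<bar> \<partial>M) \<le> 3 * c0 * (\<integral>x. \<bar>W x * r (W x)\<bar> \<partial>M)"
    using c0 by (intro mult_right_mono) auto
  moreover have "0 \<le> second_moment_defect" by (simp add: second_moment_defect_def)
  ultimately show "\<bar>measure M {x \<in> space M. W x \<le> z} - measure N {y \<in> space N. Y y \<le> z}\<bar>
      \<le> 3 * (\<integral>x. \<bar>1 - (c0 / 2) * real_cond_exp M (sigma_of M W) (\<lambda>x. (W x - W' x)\<^sup>2) x\<bar> \<partial>M)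
       + \<delta> + 2 * c0 * \<delta> ^ 3 + 3 * c0 * (\<integral>x. \<bar>W x * r (W x)\<bar> \<partial>M)"
    using kolmogorov_bound[OF assms(9,10) bd, of z]
    unfolding second_moment_defect_def[symmetric] by linarith
qed

end
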